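(* Let $d\ge 2$ and $m\ge 2$ be integers and put $n=m^d-(m-1)^d+m^d$. Then the cube $[0,m]^d$ can be decomposed into exactly $n$ cubes, all of whose side lengths belong to the interval $\left[1-\frac1m,\,1\right]$. Moreover, $n<(m+1)^d$, the number $n$ is not a perfect $d$-th power, and, for fixed $d$, $m=n^{1/d}(1+o(1))$ as $m\to\infty$.
   Context: A decomposition (tessellation, tiling) of a $d$-dimensional cube $Q\subset\mathbb{R}^d$ into $n$ cubes is a family of $n$ closed $d$-dimensional cubes (of positive side length) with pairwise disjoint interiors whose union is $Q$. A perfect $d$-th power is an integer of the form $k^d$ with $k$ a positive integer. *)

theory Defs
  imports "HOL-Analysis.Analysis" "HOL-Library.Landau_Symbols"
begin

text \<open>Cubes are arbitrary congruent copies of \<open>[0,s]\<^sup>d\<close>; they need not be axis-parallel.\<close>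

definition is_cube :: "real \<Rightarrow> (real ^ 'd) set \<Rightarrow> bool" where
  "is_cube s S \<longleftrightarrow> s > 0 \<and>
     (\<exists>a (f :: real ^ 'd \<Rightarrow> real ^ 'd). orthogonal_transformation f \<and> S = (\<lambda>x. a + f x) ` cbox 0 (\<chi> i. s))"

text \<open>A decomposition is given by the set of its cubes. Cubes have nonempty interior, so distinct
  members of a family with pairwise disjoint interiors are distinct sets, and the number of cubes
  is the cardinality of that set.\<close>

definition cube_decomposition :: "(real ^ 'd) set \<Rightarrow> (real ^ 'd) set set \<Rightarrow> bool" where
  "cube_decomposition Q C \<longleftrightarrow> finite C \<and> (\<forall>S\<in>C. \<exists>s. is_cube s S) \<and>
     pairwise (\<lambda>S T. interior S \<inter> interior T = {}) C \<and> \<Union>C = Q"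

end

theory Submission
  imports Defs
begin

text \<open>Cut \<open>[0,m]\<^sup>d\<close> into unit cubes, keep those outside \<open>[0,m-1]\<^sup>d\<close>, and cut \<open>[0,m-1]\<^sup>d\<close>
  afresh into \<open>m\<^sup>d\<close> cubes of side \<open>1 - 1/m\<close>. Strict convexity of \<open>x \<mapsto> x\<^sup>d\<close> puts the number of pieces
  strictly between \<open>m\<^sup>d\<close> and \<open>(m+1)\<^sup>d\<close>.\<close>

section \<open>Strict convexity of powers at three consecutive integers\<close>

lemma power_strict_convex_nat:
  fixes k d :: nat
  assumes "d \<ge> 2"
  shows "2 * (k + 1) ^ d < (k + 2) ^ d + k ^ d"
  using assms
proof (induction d rule: dec_induct)
  case base
  show ?case by (simp add: power2_eq_square)
next
  case (step d)
  have "k ^ d \<le> (k + 2) ^ d" by (simp add: power_mono)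
  \<comment> \<open>Expanding, the right-hand side equals \<open>(k + 2) ^ Suc d + k ^ Suc d\<close>
    minus \<open>(k + 2) ^ d - k ^ d\<close>, and this difference is nonnegative by the previous
    fact.\<close>
  moreover have "2 * (k + 1) ^ Suc d < (k + 1) * ((k + 2) ^ d + k ^ d)"
    using mult_strict_left_mono[OF step.IH, of "k + 1"] by (simp add: algebra_simps)
  ultimately show ?case by (simp add: algebra_simps)
qed

section \<open>The side length as an invariant of the set\<close>

lemma diameter_isometric_image:
  assumes "\<And>x y. x \<in> S \<Longrightarrow> y \<in> S \<Longrightarrow> dist (g x) (g y) = dist x y"
  shows "diameter (g ` S) = diameter S"
proof -
  have "(\<lambda>(x, y). dist x y) ` (g ` S \<times> g ` S) = (\<lambda>(x, y). dist x y) ` (S \<times> S)"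
    using assms by (force simp: image_iff)
  then show ?thesis by (simp add: diameter_def)
qed

text \<open>A rigid motion preserves the diameter, and that of the reference box is the distance
  between opposite corners. Here \<open>1\<close> is the all-ones vector, so its norm is the square
  root of the dimension.\<close>

lemma is_cube_diameter:
  fixes S :: "(real ^ 'd) set"
  assumes "is_cube s S"
  shows "diameter S = s * norm (1 :: real ^ 'd)"
proof -
  obtain a and f :: "real ^ 'd \<Rightarrow> real ^ 'd" where s: "s > 0" and f: "orthogonal_transformation f"
    and S: "S = (\<lambda>x. a + f x) ` cbox 0 (\<chi> i. s)"
    using assms unfolding is_cube_def by blast
  have c: "(\<chi> i. s) = s *\<^sub>R (1 :: real ^ 'd)"
    by (simp add: vec_eq_iff)
  have "diameter S = diameter (cbox 0 (\<chi> i. s) :: (real ^ 'd) set)"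
    unfolding S using f
    by (intro diameter_isometric_image) (simp add: orthogonal_transformation_isometry)
  also have "\<dots> = dist 0 (\<chi> i. s :: real ^ 'd)"
    using s by (intro diameter_cbox) (auto simp: Basis_vec_def inner_axis)
  finally show ?thesis using s by (simp add: c)
qed

text \<open>The side is the diameter divided by a nonzero constant. A set may be presented as a cube
  through several motions; this fact makes a claim about every \<open>s\<close> with
  \<open>is_cube s S\<close> checkable on one presentation.\<close>

lemma is_cube_side_unique:
  fixes S :: "(real ^ 'd) set"
  assumes "is_cube s S" "is_cube t S"
  shows "s = t"
proof -
  have "s * norm (1 :: real ^ 'd) = t * norm (1 :: real ^ 'd)"
    using assms by (simp flip: is_cube_diameter)
  moreover have "(1 :: real ^ 'd) \<noteq> 0" by (simp add: vec_eq_iff)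
  ultimately show ?thesis by simp
qed

section \<open>Cells of a cubical grid with a corner at the origin\<close>

definition grid_cell :: "real \<Rightarrow> ('d \<Rightarrow> nat) \<Rightarrow> (real ^ 'd) set" where
  "grid_cell h v = cbox (\<chi> i. h * real (v i)) (\<chi> i. h * (real (v i) + 1))"

lemma mem_grid_cell:
  "x \<in> grid_cell h v \<longleftrightarrow> (\<forall>i. h * real (v i) \<le> x $ i \<and> x $ i \<le> h * (real (v i) + 1))"
  by (simp add: grid_cell_def mem_box_cart)

lemma interior_grid_cell:
  "x \<in> interior (grid_cell h v) \<longleftrightarrow>
    (\<forall>i. h * real (v i) < x $ i \<and> x $ i < h * (real (v i) + 1))"
  by (simp add: grid_cell_def interior_cbox mem_box_cart)

lemma is_cube_grid_cell:
  assumes "h > 0"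
  shows "is_cube h (grid_cell h v)"
  unfolding is_cube_def
proof (intro conjI exI)
  show "orthogonal_transformation id" by (rule orthogonal_transformation_id[folded id_def])
  \<comment> \<open>The summand \<open>0\<close> is kept so that both corners have the shape
    required by \<open>cbox_translation\<close>.\<close>
  have "grid_cell h v = cbox ((\<chi> i. h * real (v i)) + 0) ((\<chi> i. h * real (v i)) + (\<chi> i. h))"
    unfolding grid_cell_def by (rule arg_cong2[where f = cbox]) (auto simp: vec_eq_iff algebra_simps)
  then show "grid_cell h v = (\<lambda>x. (\<chi> i. h * real (v i)) + id x) ` cbox 0 (\<chi> i. h)"
    by (simp add: cbox_translation del: add_0_right)
qed fact

lemma interior_grid_cell_nonempty:
  assumes "h > 0"
  shows "interior (grid_cell h v) \<noteq> {}"
proof -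
  have "(\<chi> i. h * (real (v i) + 1/2)) \<in> interior (grid_cell h v)"
    using assms by (simp add: interior_grid_cell)
  then show ?thesis by blast
qed

lemma grid_cell_disjoint:
  assumes "h > 0" "v \<noteq> w"
  shows "interior (grid_cell h v) \<inter> interior (grid_cell h w) = {}"
proof -
  have False if x: "x \<in> interior (grid_cell h v)" "x \<in> interior (grid_cell h w)" for x
  proof -
    obtain i where i: "v i \<noteq> w i" using assms by blast
    \<comment> \<open>Both open intervals contain \<open>x $ i\<close>. Dividing by \<open>h\<close>
      puts the integers \<open>v i\<close> and \<open>w i\<close> less than 1 apart, so they
      agree.\<close>
    have "h * real (v i) < h * (real (w i) + 1)" "h * real (w i) < h * (real (v i) + 1)"
      using x unfolding interior_grid_cell by (meson less_trans)+
    then have "real (v i) < real (w i) + 1" "real (w i) < real (v i) + 1"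
      using \<open>h > 0\<close> by simp_all
    then show False using i by linarith
  qed
  then show ?thesis by blast
qed

text \<open>Equal cells with different indices would have an interior disjoint from itself, hence
  empty. Injectivity lets cells be counted by their indices.\<close>

lemma inj_grid_cell:
  assumes "h > 0"
  shows "inj (grid_cell h)"
  using grid_cell_disjoint[OF assms] interior_grid_cell_nonempty[OF assms]
  by (metis injI inf.idem)

text \<open>Truncating at \<open>m - 1\<close> places a point with a coordinate equal to \<open>m * h\<close> in the last layer.\<close>

lemma mem_grid_cell_floor:
  assumes "h > 0" "m \<ge> 1" "x \<in> cbox 0 (\<chi> i. h * real m)"
  shows "x \<in> grid_cell h (\<lambda>i. min (m - 1) (nat \<lfloor>x $ i / h\<rfloor>))"
  unfolding mem_grid_cell
proof
  fix i
  define y where "y = x $ i / h"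
  define k where "k = min (m - 1) (nat \<lfloor>y\<rfloor>)"
  have x: "x $ i = h * y" using assms by (simp add: y_def)
  have y: "0 \<le> y" "y \<le> real m"
    using assms by (auto simp: y_def mem_box_cart field_simps)
  have "real k \<le> y \<and> y \<le> real k + 1"
  proof (cases "nat \<lfloor>y\<rfloor> \<le> m - 1")
    case True
    then have "k = nat \<lfloor>y\<rfloor>" by (simp add: k_def)
    then show ?thesis using y by linarith
  next
    case False
    then have k: "k = m - 1" and "real (m - 1) \<le> of_int \<lfloor>y\<rfloor>"
      by (auto simp: k_def)
    then show ?thesis using y \<open>m \<ge> 1\<close> by linarith
  qed
  then show "h * real (min (m - 1) (nat \<lfloor>x $ i / h\<rfloor>)) \<le> x $ i \<and>
      x $ i \<le> h * (real (min (m - 1) (nat \<lfloor>x $ i / h\<rfloor>)) + 1)"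
    using \<open>h > 0\<close> unfolding y_def[symmetric] k_def[symmetric] unfolding x by simp
qed

definition grid_index :: "nat \<Rightarrow> ('d \<Rightarrow> nat) set" where
  "grid_index m = {v. \<forall>i. v i < m}"

text \<open>Extensionality is vacuous over \<open>UNIV\<close>; in this form finiteness and
  cardinality come from the library results on \<open>PiE\<close>.\<close>

lemma grid_index_eq_PiE: "grid_index m = (UNIV \<rightarrow>\<^sub>E {..<m})"
  by (auto simp: grid_index_def)

lemma finite_grid_index: "finite (grid_index m :: ('d::finite \<Rightarrow> nat) set)"
  by (simp add: grid_index_eq_PiE finite_PiE)

lemma card_grid_index: "card (grid_index m :: ('d::finite \<Rightarrow> nat) set) = m ^ CARD('d)"
  by (simp add: grid_index_eq_PiE card_PiE)

lemma grid_cell_subset: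
  assumes "h > 0" "v \<in> grid_index m"
  shows "grid_cell h v \<subseteq> cbox 0 (\<chi> i. h * real m)"
proof
  fix x assume x: "x \<in> grid_cell h v"
  show "x \<in> cbox 0 (\<chi> i. h * real m)"
    unfolding mem_box_cart
  proof
    fix i
    have "v i < m" using assms by (simp add: grid_index_def)
    then have "h * (real (v i) + 1) \<le> h * real m" "0 \<le> h * real (v i)"
      using \<open>h > 0\<close> by (simp_all)
    then show "0 $ i \<le> x $ i \<and> x $ i \<le> (\<chi> i. h * real m) $ i"
      using x unfolding mem_grid_cell by (auto intro: order_trans)
  qed
qed

lemma grid_cover:
  assumes "h > 0" "m \<ge> 1"
  shows "(\<Union>v\<in>grid_index m. grid_cell h v) = cbox 0 (\<chi> i. h * real m)"
proof
  show "(\<Union>v\<in>grid_index m. grid_cell h v) \<subseteq> cbox 0 (\<chi> i. h * real m)"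
    using grid_cell_subset[OF \<open>h > 0\<close>] by blast
  show "cbox 0 (\<chi> i. h * real m) \<subseteq> (\<Union>v\<in>grid_index m. grid_cell h v)"
  proof
    fix x assume "x \<in> cbox 0 (\<chi> i. h * real m)"
    then have "x \<in> grid_cell h (\<lambda>i. min (m - 1) (nat \<lfloor>x $ i / h\<rfloor>))"
      by (rule mem_grid_cell_floor[OF assms])
    moreover have "(\<lambda>i. min (m - 1) (nat \<lfloor>x $ i / h\<rfloor>)) \<in> grid_index m"
      using \<open>m \<ge> 1\<close> by (auto simp: grid_index_def)
    ultimately show "x \<in> (\<Union>v\<in>grid_index m. grid_cell h v)" by blast
  qed
qed

section \<open>The decomposition with two side lengths\<close>

lemma cube_decomposition_two_scales:
  fixes m :: nat
  assumes "m \<ge> 2"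
  shows "\<exists>C :: (real ^ 'd) set set.
    cube_decomposition (cbox 0 (\<chi> i. real m)) C \<and>
    card C = m ^ CARD('d) - (m - 1) ^ CARD('d) + m ^ CARD('d) \<and>
    (\<forall>S\<in>C. \<forall>s. is_cube s S \<longrightarrow> s \<in> {1 - 1 / real m .. 1})"
proof -
  define h where "h = 1 - 1 / real m"
  have h: "h > 0" "h \<le> 1" using assms by (auto simp: h_def)
  \<comment> \<open>This is why \<open>h\<close> has its value: \<open>m\<close> cells of side
    \<open>h\<close> in a row have total length exactly \<open>m - 1\<close>.\<close>
  have hm: "h * real m = real (m - 1)" using assms by (simp add: h_def field_simps of_nat_diff)
  define I :: "('d \<Rightarrow> nat) set" where "I = grid_index m - grid_index (m - 1)"
  define A where "A = grid_cell 1 ` I"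
  define B :: "(real ^ 'd) set set" where "B = grid_cell h ` grid_index m"
  have UB: "\<Union>B = cbox 0 (\<chi> i. real (m - 1))"
    using grid_cover[OF \<open>h > 0\<close>, of m] assms by (simp add: B_def hm)
  have cube: "(S \<in> A \<longrightarrow> is_cube 1 S) \<and> (S \<in> B \<longrightarrow> is_cube h S)" for S
    using h by (auto simp: A_def B_def is_cube_grid_cell)
  have fin: "finite A" "finite B"
    by (simp_all add: A_def B_def I_def finite_grid_index)
  \<comment> \<open>The hyperplane where coordinate \<open>i\<close> equals \<open>m - 1\<close>
    separates them: the open unit cell lies strictly beyond it, and every small cube lies on the
    near side.\<close>
  have AB: "interior S \<inter> interior T = {}" if S: "S \<in> A" and T: "T \<in> B" for S T
  proof -
    obtain v where v: "v \<in> I" "S = grid_cell 1 v" using S by (auto simp: A_def)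
    then obtain i where i: "v i \<ge> m - 1" by (auto simp: I_def grid_index_def not_less)
    have False if "x \<in> interior S" "x \<in> interior T" for x
    proof -
      have "x \<in> cbox 0 (\<chi> i. real (m - 1))"
        using that(2) T interior_subset UB by blast
      then have "x $ i \<le> real (m - 1)" by (simp add: mem_box_cart)
      moreover have "real (v i) < x $ i"
        using that(1) v by (simp add: interior_grid_cell)
      ultimately show False using i by linarith
    qed
    then show ?thesis by blast
  qed
  have cells: "pairwise (\<lambda>S T. interior S \<inter> interior T = {}) (grid_cell e ` J)"
    if "e > 0" for e and J :: "('d \<Rightarrow> nat) set"
    by (rule pairwise_imageI) (rule grid_cell_disjoint[OF that])
  have pw: "pairwise (\<lambda>S T. interior S \<inter> interior T = {}) (A \<union> B)"
    using cells[of 1 I] cells[OF h(1), of "grid_index m"] AB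
    unfolding A_def[symmetric] B_def[symmetric] pairwise_def by auto blast+
  \<comment> \<open>The cardinalities of \<open>A\<close> and \<open>B\<close> add only if no set
    belongs to both; a common member would have empty interior.\<close>
  have disj: "A \<inter> B = {}"
  proof -
    have "interior S \<noteq> {}" if "S \<in> A" for S
      using that by (auto simp: A_def interior_grid_cell_nonempty)
    then show ?thesis using AB by blast
  qed
  have cover: "\<Union>(A \<union> B) = cbox 0 (\<chi> i. real m)"
  proof
    have "\<Union>A \<subseteq> cbox 0 (\<chi> i. real m)"
      using grid_cell_subset[of 1 _ m] by (auto simp: A_def I_def)
    moreover have "x $ i \<le> real m" if "x $ i \<le> real (m - 1)" for x :: "real ^ 'd" and i
      using that by linarith
    then have "\<Union>B \<subseteq> cbox 0 (\<chi> i. real m)"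
      unfolding UB by (simp add: subset_iff mem_box_cart)
    ultimately show "\<Union>(A \<union> B) \<subseteq> cbox 0 (\<chi> i. real m)" by blast
    show "cbox 0 (\<chi> i. real m) \<subseteq> \<Union>(A \<union> B)"
    proof
      fix x :: "real ^ 'd" assume x: "x \<in> cbox 0 (\<chi> i. real m)"
      show "x \<in> \<Union>(A \<union> B)"
      proof (cases "x \<in> cbox 0 (\<chi> i. real (m - 1))")
        case True
        then show ?thesis using UB by blast
      next
        case False
        then obtain i where i: "x $ i > real (m - 1)"
          using x unfolding mem_box_cart by (auto simp: not_le) (meson not_less)
        define v where "v = (\<lambda>i. min (m - 1) (nat \<lfloor>x $ i\<rfloor>))"
        \<comment> \<open>A coordinate beyond \<open>m - 1\<close> is truncated to exactly
          \<open>m - 1\<close>, so the cell found for \<open>x\<close> is one of the unit cells that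
          were kept.\<close>
        have "m - 1 \<le> nat \<lfloor>x $ i\<rfloor>" using i by linarith
        then have "v i = m - 1" by (simp add: v_def)
        moreover have "v j < m" for j using assms by (simp add: v_def min_def) linarith
        ultimately have "v \<in> I"
          by (auto simp: I_def grid_index_def intro: exI[of _ i])
        moreover have "x \<in> grid_cell 1 v"
          using mem_grid_cell_floor[of 1 m x] x assms by (simp add: v_def)
        ultimately show ?thesis by (auto simp: A_def)
      qed
    qed
  qed
  have "grid_index (m - 1) \<subseteq> (grid_index m :: ('d \<Rightarrow> nat) set)"
    unfolding grid_index_def by (auto intro: less_le_trans)
  then have "card I = m ^ CARD('d) - (m - 1) ^ CARD('d)"
    by (simp add: I_def card_Diff_subset finite_grid_index card_grid_index)
  then have cardA: "card A = m ^ CARD('d) - (m - 1) ^ CARD('d)"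
    unfolding A_def by (subst card_image) (auto intro: inj_on_subset[OF inj_grid_cell])
  have cardB: "card B = m ^ CARD('d)"
    unfolding B_def using h
    by (subst card_image) (auto intro: inj_on_subset[OF inj_grid_cell] simp: card_grid_index)
  show ?thesis
  proof (intro exI[of _ "A \<union> B"] conjI ballI allI impI)
    show "cube_decomposition (cbox 0 (\<chi> i. real m)) (A \<union> B)"
      unfolding cube_decomposition_def using fin cube pw cover by blast
    show "card (A \<union> B) = m ^ CARD('d) - (m - 1) ^ CARD('d) + m ^ CARD('d)"
      using fin disj cardA cardB by (simp add: card_Un_disjoint)
    fix S s assume "S \<in> A \<union> B" "is_cube s S"
    then have "s = 1 \<or> s = h" using cube is_cube_side_unique by blast
    then show "s \<in> {1 - 1 / real m .. 1}" using h by (auto simp: h_def)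
  qed
qed

section \<open>Bounds on the number of pieces and the asymptotics\<close>

theorem mainTheorem2:
  fixes d :: nat and n :: "nat \<Rightarrow> nat"
  assumes "d = CARD('d::finite)" and "d \<ge> 2"
    and "\<And>m. n m = m ^ d - (m - 1) ^ d + m ^ d"
  shows "(\<forall>m\<ge>2.
            (\<exists>C :: (real ^ 'd) set set.
               cube_decomposition (cbox 0 (\<chi> i. real m)) C \<and> card C = n m \<and>
               (\<forall>S\<in>C. \<forall>s. is_cube s S \<longrightarrow> s \<in> {1 - 1 / real m .. 1})) \<and>
            n m < (m + 1) ^ d \<and>
            \<not> (\<exists>k\<ge>1. n m = k ^ d)) \<and>
         (\<exists>\<epsilon> :: nat \<Rightarrow> real. \<epsilon> \<in> o(\<lambda>_. 1) \<and>
            (\<forall>m\<ge>2. real m = real (n m) powr (1 / real d) * (1 + \<epsilon> m)))"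
proof -
  \<comment> \<open>This strict sandwich between consecutive \<open>d\<close>-th powers excludes
    perfect powers and, after taking roots, controls the error term.\<close>
  have bounds: "m ^ d < n m" "n m < (m + 1) ^ d" if "m \<ge> 1" for m
  proof -
    have less: "(m - 1) ^ d < m ^ d" using that assms(2) by (simp add: power_strict_mono)
    then show "m ^ d < n m" by (simp add: assms(3))
    \<comment> \<open>Convexity is applied with \<open>k = m - 1\<close>, so that the middle point
      is \<open>m\<close>.\<close>
    have "2 * (m - 1 + 1) ^ d < (m - 1 + 2) ^ d + (m - 1) ^ d"
      using assms(2) by (rule power_strict_convex_nat)
    moreover have "m - 1 + 1 = m" "m - 1 + 2 = m + 1" using that by simp_all
    ultimately have "2 * m ^ d < (m + 1) ^ d + (m - 1) ^ d" by (simp only:)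
    then show "n m < (m + 1) ^ d" using less by (simp add: assms(3))
  qed
  have no_power: "n m \<noteq> k ^ d" if "m \<ge> 1" for m k
  proof
    assume "n m = k ^ d"
    then have "m < k" "k < m + 1"
      using bounds[OF that] by (metis power_less_imp_less_base zero_le)+
    then show False by simp
  qed
  define r where "r m = real (n m) powr (1 / real d)" for m
  \<comment> \<open>Solving \<open>m = r m * (1 + \<epsilon> m)\<close> for the error makes the
    required identity exact wherever \<open>r m\<close> is nonzero; only the limit remains to be
    shown.\<close>
  define \<epsilon> where "\<epsilon> m = real m / r m - 1" for m
  have root: "(real k ^ d) powr (1 / real d) = real k" if "k \<ge> 1" for k
    using that assms(2) by (simp add: powr_powr flip: powr_realpow)
  have r: "real m \<le> r m" "r m \<le> real m + 1" if "m \<ge> 1" for m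
  proof -
    have "real m ^ d \<le> real (n m)" "real (n m) \<le> real (m + 1) ^ d"
      using bounds[OF that] by (simp_all only: of_nat_power [symmetric] of_nat_le_iff less_imp_le)
    then have "(real m ^ d) powr (1 / real d) \<le> r m" "r m \<le> (real (m + 1) ^ d) powr (1 / real d)"
      unfolding r_def by (intro powr_mono2; simp)+
    then show "real m \<le> r m" "r m \<le> real m + 1"
      using root[of m] root[of "m + 1"] that by simp_all
  qed
  have "\<epsilon> \<longlonglongrightarrow> 0"
  proof (rule Lim_null_comparison)
    show "(\<lambda>m. 1 / real m) \<longlonglongrightarrow> 0" by (rule lim_1_over_n)
    show "\<forall>\<^sub>F m in sequentially. norm (\<epsilon> m) \<le> 1 / real m"
    proof (rule eventually_sequentiallyI[of 1])
      fix m :: nat assume m: "1 \<le> m"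
      then have pos: "0 < real m" "0 < r m" using r[of m] by simp_all
      have "norm (\<epsilon> m) = (r m - real m) / r m"
        using r[OF m] pos by (simp add: \<epsilon>_def abs_if field_simps)
      \<comment> \<open>The numerator is at most 1 and the denominator at least \<open>m\<close>,
        since \<open>r m\<close> lies between \<open>m\<close> and \<open>m + 1\<close>.\<close>
      also have "\<dots> \<le> 1 / real m"
        using r[OF m] pos by (intro frac_le) auto
      finally show "norm (\<epsilon> m) \<le> 1 / real m" .
    qed
  qed
  then have "\<epsilon> \<in> o(\<lambda>_. 1)" by (intro smalloI_tendsto) auto
  moreover have "real m = r m * (1 + \<epsilon> m)" if "m \<ge> 2" for m
    using r[of m] that by (simp add: \<epsilon>_def)
  ultimately have "\<exists>\<epsilon> :: nat \<Rightarrow> real. \<epsilon> \<in> o(\<lambda>_. 1) \<and>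
      (\<forall>m\<ge>2. real m = real (n m) powr (1 / real d) * (1 + \<epsilon> m))"
    unfolding r_def by blast
  moreover have "\<exists>C :: (real ^ 'd) set set.
      cube_decomposition (cbox 0 (\<chi> i. real m)) C \<and> card C = n m \<and>
      (\<forall>S\<in>C. \<forall>s. is_cube s S \<longrightarrow> s \<in> {1 - 1 / real m .. 1})" if "m \<ge> 2" for m
    using cube_decomposition_two_scales[OF that, where 'd = 'd] by (simp add: assms)
  ultimately show ?thesis
    using bounds(2) no_power by (meson le_trans one_le_numeral)
qed

end
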